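(* Let $\Phi_1,\dots,\Phi_J,\Omega\in\mathfrak{g}$. Then for some $q\geq 1$ there exist $\Theta\in\mathfrak{g}_q$, $\Theta\neq 0$, and $R\in\mathcal{R}_{q+1}$ such that $$e^{\Phi_J}\cdots e^{\Phi_1}=e^{\Omega}+\Theta+R .$$
   Context: Let $\mathcal{A}$ be one of the following finite alphabets, with grading: either $\mathcal{A}=\{A,B\}$ with $\mathrm{grade}(A)=\mathrm{grade}(B)=1$, or $\mathcal{A}=\{A_1,\dots,A_K\}$ ($K\ge 2$) with $\mathrm{grade}(A_k)=k$. Let $\mathcal{A}^*$ be the set of words over $\mathcal{A}$, including the empty word $\mathrm{Id}$. Let $\mathbb{C}\langle\mathcal{A}\rangle$ be the free associative algebra (non-commutative polynomials) and $\mathbb{C}\langle\langle\mathcal{A}\rangle\rangle$ the algebra of formal power series in the non-commuting variables $\mathcal{A}$; $\mathrm{Id}$ is the multiplicative identity. The grade of a word is the sum of the grades of its letters, and $\mathrm{grade}(\mathrm{Id})=0$. $\mathfrak{g}\subset\mathbb{C}\langle\mathcal{A}\rangle$ is the free Lie algebra generated by $\mathcal{A}$, with bracket $[X,Y]=XY-YX$. Pure elements of $\mathfrak{g}$ are the iterated commutators with single generators in their slots: every generator is pure, and if $X,Y$ are pure then $[X,Y]$ is pure, with $\mathrm{grade}([X,Y])=\mathrm{grade}(X)+\mathrm{grade}(Y)$. $\mathfrak{g}_k$ is the span of all pure elements of grade $k$, so $\mathfrak{g}=\bigoplus_{k\ge1}\mathfrak{g}_k$ (elements of $\mathfrak{g}$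 are finite sums of homogeneous elements). For $q\ge1$, $\mathcal{R}_q\subset\mathbb{C}\langle\langle\mathcal{A}\rangle\rangle$ is the ideal of all formal power series all of whose terms involve only words of grade $\ge q$. For $X\in\mathbb{C}\langle\langle\mathcal{A}\rangle\rangle$ with zero constant term, $e^X=\sum_{n\ge0}\frac{1}{n!}X^n\in\mathbb{C}\langle\langle\mathcal{A}\rangle\rangle$.
   Formalization: The formal theorem additionally assumes that the product of the exponentials e^{Φ_J}⋯e^{Φ_1} is not equal to e^Ω; without this the claim fails, e.g. for J=1 and Φ_1=Ω, where Θ+R=0 would force Θ=0. *)

theory Defs
  imports Complex_Main
begin

section \<open>Formal power series in non-commuting variables\<close>

text \<open>
  The type variable \<^typ>\<open>'a\<close> is the alphabet itself: letters are the elements of \<^typ>\<open>'a\<close>, words are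
  lists over \<^typ>\<open>'a\<close>, and a series is its family of complex coefficients, one for each word.
\<close>

typedef 'a ncseries = "UNIV :: ('a list \<Rightarrow> complex) set"
  morphisms coeff Abs_ncseries ..

setup_lifting type_definition_ncseries

lemma ncseries_eqI: "(\<And>w. coeff X w = coeff Y w) \<Longrightarrow> X = Y"
  by transfer auto

instantiation ncseries :: (type) "{zero, one, plus, minus, uminus, times}"
begin

lift_definition zero_ncseries :: "'a ncseries" is "\<lambda>_. 0" .

lift_definition one_ncseries :: "'a ncseries" is "\<lambda>w. if w = [] then 1 else 0" .

lift_definition plus_ncseries :: "'a ncseries \<Rightarrow> 'a ncseries \<Rightarrow> 'a ncseries"
  is "\<lambda>X Y w. X w + Y w" .

lift_definition minus_ncseries :: "'a ncseries \<Rightarrow> 'a ncseries \<Rightarrow> 'a ncseries"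
  is "\<lambda>X Y w. X w - Y w" .

lift_definition uminus_ncseries :: "'a ncseries \<Rightarrow> 'a ncseries"
  is "\<lambda>X w. - X w" .

text \<open>The sum runs over all factorizations of the word \<open>w\<close> as a concatenation of two words.\<close>

lift_definition times_ncseries :: "'a ncseries \<Rightarrow> 'a ncseries \<Rightarrow> 'a ncseries"
  is "\<lambda>X Y w. \<Sum>i\<le>length w. X (take i w) * Y (drop i w)" .

instance ..

end

lemmas coeff_simps [simp] =
  zero_ncseries.rep_eq one_ncseries.rep_eq plus_ncseries.rep_eq
  minus_ncseries.rep_eq uminus_ncseries.rep_eq

lemmas coeff_mult = times_ncseries.rep_eq

lemma sum_triangle_assoc:
  fixes f :: "nat \<Rightarrow> nat \<Rightarrow> complex"
  shows "(\<Sum>j\<le>n. \<Sum>i\<le>j. f i j) = (\<Sum>i\<le>n. \<Sum>k\<le>n - i. f i (i + k))"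
proof -
  have "(\<Sum>j\<le>n. \<Sum>i\<le>j. f i j) = (\<Sum>(i, k)\<in>{(i, k). i + k \<le> n}. f i (i + k))"
    unfolding sum.triangle_reindex_eq by simp
  also have "{(i, k). i + k \<le> n} = Sigma {..n} (\<lambda>i. {..n - i})"
    by auto
  finally show ?thesis
    by (simp add: sum.Sigma)
qed

instance ncseries :: (type) ring_1
proof
  fix X Y Z :: "'a ncseries"
  show "X * Y * Z = X * (Y * Z)"
  proof (rule ncseries_eqI)
    fix w
    have "coeff (X * Y * Z) w =
      (\<Sum>j\<le>length w. \<Sum>i\<le>j. coeff X (take i w) * coeff Y (drop i (take j w)) * coeff Z (drop j w))"
      by (auto simp: coeff_mult sum_distrib_right min_def intro!: sum.cong)
    also have "\<dots> = (\<Sum>i\<le>length w. \<Sum>k\<le>length w - i.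
        coeff X (take i w) * coeff Y (drop i (take (i + k) w)) * coeff Z (drop (i + k) w))"
      by (rule sum_triangle_assoc)
    also have "\<dots> = coeff (X * (Y * Z)) w"
      by (auto simp: coeff_mult sum_distrib_left drop_take mult.assoc add.commute intro!: sum.cong)
    finally show "coeff (X * Y * Z) w = coeff (X * (Y * Z)) w" .
  qed
  show "1 * X = X"
  proof (rule ncseries_eqI)
    fix w
    have "coeff (1 * X) w = (\<Sum>i\<le>length w. if i = 0 then coeff X w else 0)"
      unfolding coeff_mult by (rule sum.cong) auto
    then show "coeff (1 * X) w = coeff X w" by simp
  qed
  show "X * 1 = X"
  proof (rule ncseries_eqI)
    fix w
    have "coeff (X * 1) w = (\<Sum>i\<le>length w. if i = length w then coeff X w else 0)"
      unfolding coeff_mult by (rule sum.cong) auto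
    then show "coeff (X * 1) w = coeff X w" by simp
  qed
  have "coeff (0 :: 'a ncseries) [] \<noteq> coeff 1 []" by simp
  then show "(0 :: 'a ncseries) \<noteq> 1" by metis
qed (auto intro!: ncseries_eqI simp: coeff_mult sum.distrib algebra_simps)

lift_definition letter :: "'a \<Rightarrow> 'a ncseries" is "\<lambda>a w. if w = [a] then 1 else 0" .

lift_definition ncscale :: "complex \<Rightarrow> 'a ncseries \<Rightarrow> 'a ncseries" is "\<lambda>c X w. c * X w" .

global_interpretation ncseries: vector_space ncscale
  by unfold_locales (auto intro!: ncseries_eqI simp: ncscale.rep_eq algebra_simps)

text \<open>
  The infinite sum is taken coefficient by coefficient. If the constant term of \<open>X\<close> vanishes, only
  finitely many summands contribute to each coefficient, see \<open>ncexp_finite\<close> below.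
\<close>

definition ncexp :: "'a ncseries \<Rightarrow> 'a ncseries" where
  "ncexp X = Abs_ncseries (\<lambda>w. \<Sum>n. coeff (X ^ n) w / fact n)"

lemma coeff_power_eq_0:
  assumes "coeff X [] = 0" and "length w < n"
  shows "coeff (X ^ n) w = 0"
  using assms(2)
proof (induction n arbitrary: w)
  case (Suc n)
  have "coeff X (take i w) * coeff (X ^ n) (drop i w) = 0" if "i \<le> length w" for i
    using Suc that assms(1) by (cases "i = 0") auto
  then show ?case unfolding power_Suc coeff_mult by (intro sum.neutral) simp
qed simp

lemma ncexp_finite:
  assumes "coeff X [] = 0"
  shows "coeff (ncexp X) w = (\<Sum>n\<le>length w. coeff (X ^ n) w / fact n)"
  unfolding ncexp_def using assms
  by (subst Abs_ncseries_inverse) (auto intro!: suminf_finite dest: coeff_power_eq_0 simp: not_le)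

section \<open>The free Lie algebra and its grading\<close>

definition lie_bracket :: "'a ncseries \<Rightarrow> 'a ncseries \<Rightarrow> 'a ncseries" where
  "lie_bracket X Y = X * Y - Y * X"

definition lie_subalgebra :: "'a ncseries set \<Rightarrow> bool" where
  "lie_subalgebra L \<longleftrightarrow> ncseries.subspace L \<and> (\<forall>X\<in>L. \<forall>Y\<in>L. lie_bracket X Y \<in> L)"

definition free_lie :: "'a ncseries set" where
  "free_lie = lie_subalgebra hull (range letter)"

inductive pure_element :: "('a \<Rightarrow> nat) \<Rightarrow> nat \<Rightarrow> 'a ncseries \<Rightarrow> bool" for grade where
  letter: "pure_element grade (grade a) (letter a)"
| bracket: "pure_element grade k X \<Longrightarrow> pure_element grade l Y \<Longrightarrow>
    pure_element grade (k + l) (lie_bracket X Y)"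

definition free_lie_grade :: "('a \<Rightarrow> nat) \<Rightarrow> nat \<Rightarrow> 'a ncseries set" where
  "free_lie_grade grade k = ncseries.span {X. pure_element grade k X}"

definition word_grade :: "('a \<Rightarrow> nat) \<Rightarrow> 'a list \<Rightarrow> nat" where
  "word_grade grade w = sum_list (map grade w)"

definition remainder :: "('a \<Rightarrow> nat) \<Rightarrow> nat \<Rightarrow> 'a ncseries set" where
  "remainder grade q = {X. \<forall>w. coeff X w \<noteq> 0 \<longrightarrow> q \<le> word_grade grade w}"

text \<open>
  The two admissible graded alphabets: \<open>{A, B}\<close> with both letters of grade 1, or
  \<open>{A\<^sub>1, \<dots>, A\<^sub>K}\<close> with \<open>K \<ge> 2\<close> and \<open>A\<^sub>k\<close> of grade \<open>k\<close>.
\<close>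

definition admissible_grading :: "('a \<Rightarrow> nat) \<Rightarrow> bool" where
  "admissible_grading grade \<longleftrightarrow>
     (\<exists>A B. A \<noteq> B \<and> (UNIV :: 'a set) = {A, B} \<and> grade A = 1 \<and> grade B = 1) \<or>
     (\<exists>K\<ge>2. \<exists>A :: nat \<Rightarrow> 'a. bij_betw A {1..K} UNIV \<and> (\<forall>k\<in>{1..K}. grade (A k) = k))"

lemma lie_subalgebra_span_pure:
  "lie_subalgebra (ncseries.span {X. \<exists>k. pure_element grade k X})"
proof -
  let ?P = "{X. \<exists>k. pure_element grade k X}"
  have br: "lie_bracket X Y \<in> ncseries.span ?P" if "X \<in> ?P" "Y \<in> ?P" for X Y
    using that by (auto intro!: ncseries.span_base intro: pure_element.bracket)
  have add: "lie_bracket (X + X') Y = lie_bracket X Y + lie_bracket X' Y"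
    "lie_bracket Y (X + X') = lie_bracket Y X + lie_bracket Y X'" for X X' Y :: "'a ncseries"
    by (simp_all add: lie_bracket_def algebra_simps)
  have sc: "lie_bracket (ncscale c X) Y = ncscale c (lie_bracket X Y)"
    "lie_bracket Y (ncscale c X) = ncscale c (lie_bracket Y X)" for c and X Y :: "'a ncseries"
    by (auto intro!: ncseries_eqI
        simp: lie_bracket_def coeff_mult ncscale.rep_eq sum_distrib_left algebra_simps)
  have z: "lie_bracket 0 Y = 0" "lie_bracket Y 0 = 0" for Y :: "'a ncseries"
    by (simp_all add: lie_bracket_def)
  have 1: "lie_bracket X Y \<in> ncseries.span ?P" if "X \<in> ncseries.span ?P" "Y \<in> ?P" for X Y
    using that(1)
  proof (induction rule: ncseries.span_induct_alt)
    case (step c x y)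
    show ?case
      unfolding add sc
      by (rule ncseries.span_add[OF ncseries.span_scale[OF br[OF step(1) that(2)]] step(2)])
  qed (simp add: z ncseries.span_zero)
  have "lie_bracket X Y \<in> ncseries.span ?P"
    if "X \<in> ncseries.span ?P" "Y \<in> ncseries.span ?P" for X Y
    using that(2)
  proof (induction rule: ncseries.span_induct_alt)
    case (step c x y)
    show ?case
      unfolding add sc
      by (rule ncseries.span_add[OF ncseries.span_scale[OF 1[OF that(1) step(1)]] step(2)])
  qed (simp add: z ncseries.span_zero)
  then show ?thesis by (simp add: lie_subalgebra_def)
qed

lemma free_lie_eq_span_pure:
  "free_lie = ncseries.span {X. \<exists>k. pure_element grade k X}"
proof
  show "free_lie \<subseteq> ncseries.span {X. \<exists>k. pure_element grade k X}"
    unfolding free_lie_def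
    by (rule hull_minimal) (auto intro: ncseries.span_base pure_element.letter lie_subalgebra_span_pure)
next
  have sub: "lie_subalgebra (free_lie :: 'a ncseries set)"
    unfolding free_lie_def
    by (rule hull_in) (auto simp: lie_subalgebra_def ncseries.subspace_def)
  have gen: "letter a \<in> free_lie" for a :: 'a
    unfolding free_lie_def by (rule hull_inc) simp
  have "X \<in> free_lie" if "pure_element grade k X" for k and X :: "'a ncseries"
    using that by (induction rule: pure_element.induct) (use gen sub in \<open>auto simp: lie_subalgebra_def\<close>)
  then show "ncseries.span {X. \<exists>k. pure_element grade k X} \<subseteq> free_lie"
    using sub by (intro ncseries.span_minimal) (auto simp: lie_subalgebra_def)
qed

text \<open>In particular the exponential is only ever applied where \<open>ncexp_finite\<close> is available:\<close>

lemma free_lie_constant_term: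
  assumes "X \<in> free_lie"
  shows "coeff X [] = 0"
proof -
  have "free_lie \<subseteq> {X :: 'a ncseries. coeff X [] = 0}"
    unfolding free_lie_def
    by (rule hull_minimal)
      (auto simp: letter.rep_eq lie_subalgebra_def ncseries.subspace_def ncscale.rep_eq
        lie_bracket_def coeff_mult)
  with assms show ?thesis by auto
qed

end

theory Submission
  imports Defs "HOL-Library.Multiset"
begin

text \<open>
  Exponentials of Lie elements, and hence their products, are group-like: the pairing with a shuffle
  product \<open>u \<squnion> v\<close> is the product of the pairings with \<open>u\<close> and \<open>v\<close>. If two group-like series
  agree in all grades below \<open>q\<close>, then the part \<open>\<Theta>\<close> of grade \<open>q\<close> of their difference vanishes on
  all shuffles of nonempty words, because both factors of \<open>P(u) P(v) - E(u) E(v)\<close> are of smaller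
  grade. So \<open>\<Theta>\<close> is primitive, and the Dynkin--Specht--Wever theorem exhibits it as a Lie element.
\<close>

section \<open>Pairing a series with shuffle products\<close>

text \<open>
  \<open>shuffle_pair f u v\<close> is the pairing of \<open>f\<close> with the shuffle product of \<open>u\<close> and \<open>v\<close>, that is, the
  coefficient of \<open>u \<otimes> v\<close> in the coproduct of \<open>f\<close>.
\<close>

fun shuffle_pair :: "('a list \<Rightarrow> complex) \<Rightarrow> 'a list \<Rightarrow> 'a list \<Rightarrow> complex" where
  "shuffle_pair f [] [] = f []"
| "shuffle_pair f (a # u) [] = shuffle_pair (\<lambda>w. f (a # w)) u []"
| "shuffle_pair f [] (b # v) = shuffle_pair (\<lambda>w. f (b # w)) [] v"
| "shuffle_pair f (a # u) (b # v) =
     shuffle_pair (\<lambda>w. f (a # w)) u (b # v) + shuffle_pair (\<lambda>w. f (b # w)) (a # u) v"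

lemma shuffle_pair_Nil [simp]:
  "shuffle_pair f u [] = f u" "shuffle_pair f [] v = f v"
proof -
  show "shuffle_pair f u [] = f u" by (induction u arbitrary: f) auto
  show "shuffle_pair f [] v = f v" by (induction v arbitrary: f) auto
qed

text \<open>Every shuffle of \<open>u\<close> and \<open>v\<close> rearranges their letters, so
  \<open>f\<close> is evaluated only at words with the combined multiset. This fixes both length and
  grade, which allows truncating exponentials and isolating one grade.\<close>

lemma shuffle_pair_cong:
  assumes "\<And>w. mset w = mset u + mset v \<Longrightarrow> f w = g w"
  shows "shuffle_pair f u v = shuffle_pair g u v"
  using assms
proof (induction f u v arbitrary: g rule: shuffle_pair.induct)
  case (4 f a u b v)
  have "shuffle_pair (\<lambda>w. f (a # w)) u (b # v) = shuffle_pair (\<lambda>w. g (a # w)) u (b # v)"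
    by (rule "4.IH"(1), rule "4.prems") simp
  moreover have "shuffle_pair (\<lambda>w. f (b # w)) (a # u) v = shuffle_pair (\<lambda>w. g (b # w)) (a # u) v"
    by (rule "4.IH"(2), rule "4.prems") simp
  ultimately show ?case by simp
qed auto

lemma shuffle_pair_add:
  "shuffle_pair (\<lambda>w. f w + g w) u v = shuffle_pair f u v + shuffle_pair g u v"
  by (induction f u v arbitrary: g rule: shuffle_pair.induct) auto

lemma shuffle_pair_scale:
  "shuffle_pair (\<lambda>w. c * f w) u v = c * shuffle_pair f u v"
  by (induction f u v rule: shuffle_pair.induct) (auto simp: algebra_simps)

lemma shuffle_pair_diff:
  "shuffle_pair (\<lambda>w. f w - g w) u v = shuffle_pair f u v - shuffle_pair g u v"
  using shuffle_pair_add[of f "\<lambda>w. - 1 * g w" u v] shuffle_pair_scale[of "- 1" g u v] by simp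

lemma shuffle_pair_zero [simp]: "shuffle_pair (\<lambda>w. 0) u v = 0"
  using shuffle_pair_scale[of 0 "\<lambda>w. 0" u v] by simp

lemma shuffle_pair_sum:
  "shuffle_pair (\<lambda>w. \<Sum>i\<in>I. f i w) u v = (\<Sum>i\<in>I. shuffle_pair (f i) u v)"
  by (induction I rule: infinite_finite_induct) (auto simp: shuffle_pair_add)

section \<open>Cauchy products and the coproduct\<close>

definition convolution :: "('a list \<Rightarrow> complex) \<Rightarrow> ('a list \<Rightarrow> complex) \<Rightarrow> 'a list \<Rightarrow> complex" where
  "convolution f g w = (\<Sum>i\<le>length w. f (take i w) * g (drop i w))"

lemma coeff_mult_convolution: "coeff (X * Y) = convolution (coeff X) (coeff Y)"
  by (simp add: fun_eq_iff coeff_mult convolution_def)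

lemma convolution_Nil [simp]: "convolution f g [] = f [] * g []"
  by (simp add: convolution_def)

lemma convolution_Cons:
  "convolution f g (a # w) = f [] * g (a # w) + convolution (\<lambda>w. f (a # w)) g w"
  unfolding convolution_def by (simp add: sum.atMost_Suc_shift del: sum.atMost_Suc)

text \<open>The coproduct is multiplicative:\<close>

lemma shuffle_pair_convolution:
  "shuffle_pair (convolution f g) u v =
     (\<Sum>i\<le>length u. \<Sum>j\<le>length v.
        shuffle_pair f (take i u) (take j v) * shuffle_pair g (drop i u) (drop j v))"
proof (induction f u v rule: shuffle_pair.induct)
  case (4 f a u b v)
  show ?case
    by (simp add: convolution_Cons shuffle_pair_add shuffle_pair_scale "4.IH"
        sum.atMost_Suc_shift algebra_simps sum.distrib del: sum.atMost_Suc)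
qed (auto simp: convolution_def)

section \<open>Primitive and group-like series\<close>

text \<open>Says that the coproduct of \<open>f\<close> is f (x) 1 + 1 (x) f: pairs with an empty
  word automatically give \<open>f u\<close> or \<open>f v\<close>, except at the pair of two empty
  words, where \<open>f [] = 0\<close> is forced.\<close>

definition primitive :: "('a list \<Rightarrow> complex) \<Rightarrow> bool" where
  "primitive f \<longleftrightarrow> f [] = 0 \<and> (\<forall>u v. u \<noteq> [] \<longrightarrow> v \<noteq> [] \<longrightarrow> shuffle_pair f u v = 0)"

text \<open>Says that the coproduct of \<open>f\<close> is f (x) f; the value at \<open>[]\<close>
  excludes the zero series.\<close>

definition grouplike :: "('a list \<Rightarrow> complex) \<Rightarrow> bool" where
  "grouplike f \<longleftrightarrow> f [] = 1 \<and> (\<forall>u v. shuffle_pair f u v = f u * f v)"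

text \<open>Multiplying by f (x) 1 + 1 (x) f on the left leaves only the terms of the double sum in
  which one of the two prefixes is empty.\<close>

lemma shuffle_pair_primitive_convolution:
  assumes "primitive f"
  shows "shuffle_pair (convolution f g) u v =
    (\<Sum>i\<le>length u. f (take i u) * shuffle_pair g (drop i u) v) +
    (\<Sum>j\<le>length v. f (take j v) * shuffle_pair g u (drop j v))"
proof -
  \<comment> \<open>The row \<open>i = 0\<close> carries the whole sum over prefixes of
    \<open>v\<close>; its extra first summand vanishes because \<open>f [] = 0\<close>.\<close>
  have "(\<Sum>j\<le>length v. shuffle_pair f (take i u) (take j v) * shuffle_pair g (drop i u) (drop j v)) =
      f (take i u) * shuffle_pair g (drop i u) v +
      (if i = 0 then \<Sum>j\<le>length v. f (take j v) * shuffle_pair g u (drop j v) else 0)"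
    if "i \<le> length u" for i
  proof (cases "i = 0")
    case True
    then show ?thesis using assms by (simp add: primitive_def)
  next
    case False
    have "shuffle_pair f (take i u) (take j v) * shuffle_pair g (drop i u) (drop j v) =
        (if j = 0 then f (take i u) * shuffle_pair g (drop i u) v else 0)" if "j \<le> length v" for j
    proof (cases "j = 0")
      case nz: False
      have "shuffle_pair f (take i u) (take j v) = 0"
        using False nz that \<open>i \<le> length u\<close> assms unfolding primitive_def
        by (metis le_zero_eq list.size(3) take_eq_Nil)
      with nz show ?thesis by simp
    qed simp
    then have "(\<Sum>j\<le>length v. shuffle_pair f (take i u) (take j v) * shuffle_pair g (drop i u) (drop j v))
      = (\<Sum>j\<le>length v. if j = 0 then f (take i u) * shuffle_pair g (drop i u) v else 0)"
      by (intro sum.cong) auto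
    then show ?thesis using False by simp
  qed
  then show ?thesis
    unfolding shuffle_pair_convolution by (simp add: sum.distrib)
qed

text \<open>Since \<open>g\<close> is primitive too, only the full prefixes survive. The result is
  symmetric in \<open>f\<close> and \<open>g\<close>, so it cancels in a commutator.\<close>

lemma shuffle_pair_primitive_convolution_primitive:
  assumes "primitive f" "primitive g" "u \<noteq> []" "v \<noteq> []"
  shows "shuffle_pair (convolution f g) u v = f u * g v + f v * g u"
proof -
  have "(\<Sum>i\<le>length u. f (take i u) * shuffle_pair g (drop i u) v) =
      (\<Sum>i\<le>length u. if i = length u then f u * g v else 0)"
    using assms by (intro sum.cong) (auto simp: primitive_def)
  moreover have "(\<Sum>j\<le>length v. f (take j v) * shuffle_pair g u (drop j v)) =
      (\<Sum>j\<le>length v. if j = length v then f v * g u else 0)"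
    using assms by (intro sum.cong) (auto simp: primitive_def)
  ultimately show ?thesis
    unfolding shuffle_pair_primitive_convolution[OF assms(1)] by simp
qed

text \<open>A shuffle of two nonempty words has at least two letters.\<close>

lemma primitive_letter: "primitive (coeff (letter a))"
proof -
  have "shuffle_pair (coeff (letter a)) u v = shuffle_pair (\<lambda>w. 0) u v"
    if "u \<noteq> []" "v \<noteq> []" for u v
  proof (rule shuffle_pair_cong)
    fix w assume "mset w = mset u + mset v"
    then have "length w = length u + length v" by (metis size_mset size_union)
    then have "w \<noteq> [a]" using that by (cases u; cases v) auto
    then show "coeff (letter a) w = 0" by (simp add: letter.rep_eq)
  qed
  then show ?thesis by (simp add: primitive_def letter.rep_eq)
qed

text \<open>The easy half of Friedrichs' criterion: primitive series form a Lie subalgebra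
  containing the letters.\<close>

lemma primitive_free_lie:
  assumes "X \<in> free_lie"
  shows "primitive (coeff X)"
proof -
  have "lie_subalgebra {X :: 'a ncseries. primitive (coeff X)}"
    unfolding lie_subalgebra_def ncseries.subspace_def lie_bracket_def
  proof safe
    fix X Y :: "'a ncseries"
    assume XY: "primitive (coeff X)" "primitive (coeff Y)"
    have "coeff (X * Y - Y * X) =
        (\<lambda>w. convolution (coeff X) (coeff Y) w - convolution (coeff Y) (coeff X) w)"
      by (simp add: fun_eq_iff coeff_mult_convolution)
    with XY show "primitive (coeff (X * Y - Y * X))"
      by (simp add: primitive_def shuffle_pair_diff
          shuffle_pair_primitive_convolution_primitive[OF XY]
          shuffle_pair_primitive_convolution_primitive[OF XY(2,1)])
  qed (auto simp: primitive_def plus_ncseries.rep_eq[abs_def] zero_ncseries.rep_eq[abs_def]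
      ncscale.rep_eq[abs_def] shuffle_pair_add shuffle_pair_scale)
  then have "free_lie \<subseteq> {X :: 'a ncseries. primitive (coeff X)}"
    unfolding free_lie_def by (intro hull_minimal) (auto simp: primitive_letter)
  with assms show ?thesis by auto
qed

section \<open>Powers and exponentials of primitive series\<close>

lemma sum_binomial_Suc:
  fixes A B :: "nat \<Rightarrow> complex"
  shows "(\<Sum>k\<le>n. of_nat (n choose k) * (A (Suc k) * B (n - k) + A k * B (Suc (n - k)))) =
    (\<Sum>k\<le>Suc n. of_nat (Suc n choose k) * (A k * B (Suc n - k)))"
proof -
  \<comment> \<open>The additional term \<open>k = Suc n\<close> vanishes because
    \<open>n choose Suc n\<close> is 0.\<close>
  have 1: "(\<Sum>k\<le>Suc n. of_nat (n choose k) * (A k * B (Suc n - k))) =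
      (\<Sum>k\<le>n. of_nat (n choose k) * (A k * B (Suc (n - k))))"
    by (auto simp: Suc_diff_le intro!: sum.cong)
  have "(\<Sum>k\<le>Suc n. of_nat (Suc n choose k) * (A k * B (Suc n - k))) =
      A 0 * B (Suc n) + (\<Sum>k\<le>n. of_nat (n choose Suc k) * (A (Suc k) * B (n - k)))
        + (\<Sum>k\<le>n. of_nat (n choose k) * (A (Suc k) * B (n - k)))"
    by (simp add: sum.atMost_Suc_shift sum.distrib algebra_simps del: sum.atMost_Suc)
  also have "A 0 * B (Suc n) + (\<Sum>k\<le>n. of_nat (n choose Suc k) * (A (Suc k) * B (n - k))) =
      (\<Sum>k\<le>Suc n. of_nat (n choose k) * (A k * B (Suc n - k)))"
    by (simp add: sum.atMost_Suc_shift del: sum.atMost_Suc)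
  finally show ?thesis
    unfolding 1 by (simp add: sum.distrib algebra_simps)
qed

text \<open>The binomial theorem for (X (x) 1 + 1 (x) X)^n, whose two summands commute.\<close>

lemma shuffle_pair_primitive_power:
  assumes "primitive (coeff X)"
  shows "shuffle_pair (coeff (X ^ n)) u v =
    (\<Sum>k\<le>n. of_nat (n choose k) * (coeff (X ^ k) u * coeff (X ^ (n - k)) v))"
proof (induction n arbitrary: u v)
  case 0
  have "shuffle_pair (coeff 1) u v = shuffle_pair (\<lambda>w. 0) u v" if "u \<noteq> []" "v \<noteq> []" for u v :: "'a list"
    by (rule shuffle_pair_cong) (use that in auto)
  then show ?case by (cases "u = []"; cases "v = []") auto
next
  case (Suc n)
  have X: "coeff (X ^ Suc k) w = (\<Sum>i\<le>length w. coeff X (take i w) * coeff (X ^ k) (drop i w))" for k w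
    by (simp add: coeff_mult)
  have "shuffle_pair (coeff (X ^ Suc n)) u v =
    (\<Sum>k\<le>n. of_nat (n choose k) *
      (coeff (X ^ Suc k) u * coeff (X ^ (n - k)) v + coeff (X ^ k) u * coeff (X ^ Suc (n - k)) v))"
    \<comment> \<open>Exchanging the sum over \<open>k\<close> with the sum over cut positions turns
      the sum over prefixes into a coefficient of \<open>X ^ Suc k\<close> at \<open>u\<close>, and
      likewise for \<open>v\<close>.\<close>
    unfolding power_Suc[of X n] coeff_mult_convolution shuffle_pair_primitive_convolution[OF assms] Suc.IH X
      distrib_left sum.distrib sum_distrib_left sum_distrib_right
    by (intro arg_cong2[where f = "(+)"]; subst sum.swap) (simp_all add: algebra_simps)
  also have "\<dots> = (\<Sum>k\<le>Suc n. of_nat (Suc n choose k) * (coeff (X ^ k) u * coeff (X ^ (Suc n - k)) v))"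
    by (rule sum_binomial_Suc)
  finally show ?case .
qed

text \<open>A freely chosen bound \<open>N\<close> lets \<open>u\<close>, \<open>v\<close> and all
  their shuffles share one truncation.\<close>

lemma coeff_ncexp:
  assumes "coeff X [] = 0" "length w \<le> N"
  shows "coeff (ncexp X) w = (\<Sum>n\<le>N. coeff (X ^ n) w / fact n)"
  unfolding ncexp_finite[OF assms(1)]
  by (rule sum.mono_neutral_left) (use assms coeff_power_eq_0[of X w] in auto)

text \<open>exp(X (x) 1 + 1 (x) X) = exp(X) (x) exp(X), because the two summands commute.\<close>

lemma grouplike_ncexp:
  assumes "primitive (coeff X)"
  shows "grouplike (coeff (ncexp X))"
proof -
  have X0: "coeff X [] = 0" using assms by (simp add: primitive_def)
  have "shuffle_pair (coeff (ncexp X)) u v = coeff (ncexp X) u * coeff (ncexp X) v" for u v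
  proof -
    define N where "N = length u + length v"
    let ?e = "\<lambda>w n. coeff (X ^ n) w / fact n"
    have "shuffle_pair (coeff (ncexp X)) u v = shuffle_pair (\<lambda>w. \<Sum>n\<le>N. 1 / fact n * coeff (X ^ n) w) u v"
    proof (rule shuffle_pair_cong)
      fix w assume "mset w = mset u + mset v"
      then have "length w = N" unfolding N_def by (metis size_mset size_union)
      then show "coeff (ncexp X) w = (\<Sum>n\<le>N. 1 / fact n * coeff (X ^ n) w)"
        by (simp add: coeff_ncexp[OF X0])
    qed
    \<comment> \<open>The binomial coefficient divided by n! is 1 / (k! (n - k)!).\<close>
    also have "\<dots> = (\<Sum>n\<le>N. \<Sum>k\<le>n. ?e u k * ?e v (n - k))"
      by (auto simp: shuffle_pair_sum shuffle_pair_scale shuffle_pair_primitive_power[OF assms]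
          sum_distrib_left sum_divide_distrib binomial_fact field_simps
          simp del: times_divide_eq_left intro!: sum.cong)
    also have "\<dots> = (\<Sum>i\<le>N. \<Sum>j\<le>N - i. ?e u i * ?e v j)"
      by (subst sum_triangle_assoc[of "\<lambda>i n. ?e u i * ?e v (n - i)"]) simp
    \<comment> \<open>The triangle may be enlarged to a square: if i + j exceeds the total length,
      one exponent exceeds the length of its word, and that coefficient is 0.\<close>
    also have "\<dots> = (\<Sum>i\<le>N. \<Sum>j\<le>N. ?e u i * ?e v j)"
    proof (rule sum.cong[OF refl], rule sum.mono_neutral_left, goal_cases)
      case (3 i)
      show ?case
      proof
        fix j assume "j \<in> {..N} - {..N - i}"
        then have "length u < i \<or> length v < j" by (auto simp: N_def)
        then show "?e u i * ?e v j = 0" using coeff_power_eq_0[OF X0] by auto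
      qed
    qed auto
    also have "\<dots> = coeff (ncexp X) u * coeff (ncexp X) v"
      by (simp add: coeff_ncexp[OF X0, of _ N] N_def sum_product)
    finally show ?thesis .
  qed
  moreover have "coeff (ncexp X) [] = 1" by (simp add: ncexp_finite[OF X0])
  ultimately show ?thesis by (simp add: grouplike_def)
qed

lemma grouplike_one: "grouplike (coeff 1)"
proof -
  have "shuffle_pair (coeff 1) u v = shuffle_pair (\<lambda>w. 0) u v" if "u \<noteq> []" "v \<noteq> []" for u v :: "'a list"
    by (rule shuffle_pair_cong) (use that in auto)
  then have "shuffle_pair (coeff 1) u v = coeff 1 u * coeff 1 v" for u v :: "'a list"
    by (cases "u = []"; cases "v = []") auto
  then show ?thesis unfolding grouplike_def by simp
qed

text \<open>By multiplicativity of the coproduct, (X (x) X)(Y (x) Y) = XY (x) XY.\<close>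

lemma grouplike_mult:
  assumes "grouplike (coeff X)" "grouplike (coeff Y)"
  shows "grouplike (coeff (X * Y))"
  using assms unfolding grouplike_def coeff_mult_convolution
  by (simp add: shuffle_pair_convolution) (simp add: convolution_def sum_product algebra_simps)

lemma grouplike_prod_list:
  assumes "\<And>X. X \<in> set Xs \<Longrightarrow> grouplike (coeff X)"
  shows "grouplike (coeff (prod_list Xs))"
  using assms by (induction Xs) (auto simp: grouplike_one grouplike_mult simp del: one_ncseries.rep_eq)

section \<open>The Dynkin operator\<close>

fun dynkin :: "'a list \<Rightarrow> 'a ncseries" where
  "dynkin [] = 0"
| "dynkin [a] = letter a"
| "dynkin (a # b # w) = lie_bracket (letter a) (dynkin (b # w))"

lemma dynkin_Cons:
  "dynkin (a # w) = letter a * dynkin w - dynkin w * letter a + (if w = [] then letter a else 0)"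
  by (cases w) (auto simp: lie_bracket_def)

lemma pure_element_dynkin:
  assumes "w \<noteq> []"
  shows "pure_element grade (word_grade grade w) (dynkin w)"
  using assms
  by (induction w rule: dynkin.induct) (auto simp: word_grade_def intro: pure_element.intros)

text \<open>The terms u (x) v of the coproduct of the monomial \<open>w\<close>: each letter goes
  left or right. A list keeps multiplicities when letters repeat.\<close>

fun deshuffles :: "'a list \<Rightarrow> ('a list \<times> 'a list) list" where
  "deshuffles [] = [([], [])]"
| "deshuffles (a # w) =
     map (\<lambda>(u, v). (a # u, v)) (deshuffles w) @ map (\<lambda>(u, v). (u, a # v)) (deshuffles w)"

abbreviation word :: "'a list \<Rightarrow> 'a ncseries" where
  "word w \<equiv> prod_list (map letter w)"

lemma coeff_word: "coeff (word u) w = (if w = u then 1 else 0)"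
proof (induction u arbitrary: w)
  case (Cons a u)
  show ?case
  proof (cases w)
    case (Cons b w')
    have "convolution (\<lambda>w. coeff (letter a) (b # w)) (coeff (word u)) w' =
        convolution (\<lambda>w. if a = b \<and> w = [] then 1 else 0) (coeff (word u)) w'"
      by (rule arg_cong[where f = "\<lambda>f. convolution f _ _"]) (auto simp: letter.rep_eq)
    also have "\<dots> = (\<Sum>i\<le>length w'. if i = 0 then (if a = b \<and> w' = u then 1 else 0) else 0)"
      unfolding convolution_def by (rule sum.cong) (auto simp: Cons.IH)
    finally show ?thesis
      using Cons by (auto simp: coeff_mult_convolution convolution_Cons letter.rep_eq)
  qed (simp add: coeff_mult letter.rep_eq)
qed simp

lemma sum_list_deshuffles_Nil:
  "(\<Sum>(u, v)\<leftarrow>deshuffles w. if u = [] then h v else 0 :: 'b :: comm_monoid_add) = h w"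
  by (induction w arbitrary: h) (auto simp: o_def case_prod_unfold cong: if_cong)

text \<open>The convolution of the Dynkin operator with the identity multiplies a word by its
  length. This is what produces the factor \<open>n\<close> in the Dynkin--Specht--Wever
  theorem.\<close>

lemma dynkin_convolution_id:
  "(\<Sum>(u, v)\<leftarrow>deshuffles w. dynkin u * word v) = of_nat (length w) * word w"
proof (induction w)
  case (Cons a w)
  have "(\<Sum>(u, v)\<leftarrow>deshuffles (a # w). dynkin u * word v) =
      (\<Sum>p\<leftarrow>deshuffles w. dynkin (a # fst p) * word (snd p) + dynkin (fst p) * (letter a * word (snd p)))"
    by (simp add: o_def case_prod_unfold sum_list_addf)
  \<comment> \<open>The term -D(u) a v of the bracket cancels against D(u) (a v), the contribution
    with \<open>a\<close> sent right.\<close>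
  also have "\<dots> = (\<Sum>p\<leftarrow>deshuffles w. letter a * (dynkin (fst p) * word (snd p)) +
      (if fst p = [] then letter a * word (snd p) else 0))"
    by (intro arg_cong[where f = sum_list] map_cong) (auto simp: dynkin_Cons algebra_simps)
  also have "\<dots> = letter a * (\<Sum>p\<leftarrow>deshuffles w. dynkin (fst p) * word (snd p)) +
      (\<Sum>p\<leftarrow>deshuffles w. if fst p = [] then letter a * word (snd p) else 0)"
    by (simp add: sum_list_addf sum_list_const_mult)
  also have "\<dots> = letter a * (of_nat (length w) * word w) + letter a * word w"
    using Cons.IH sum_list_deshuffles_Nil[of "\<lambda>v. letter a * word v" w]
    by (simp add: case_prod_unfold)
  also have "\<dots> = of_nat (length (a # w)) * word (a # w)"
    by (simp add: algebra_simps mult_of_nat_commute)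
  finally show ?case .
qed simp

text \<open>Shuffling and deshuffling are adjoint to each other.\<close>

lemma sum_deshuffles:
  fixes G :: "'a list \<times> 'a list \<Rightarrow> 'a ncseries"
  assumes "finite (UNIV :: 'a set)"
  shows "(\<Sum>w | length w = n. ncscale (f w) (\<Sum>p\<leftarrow>deshuffles w. G p)) =
    (\<Sum>(u, v) | length u + length v = n. ncscale (shuffle_pair f u v) (G (u, v)))"
proof (induction n arbitrary: f G)
  case 0
  have "{w :: 'a list. length w = 0} = {[]}"
    "{(u :: 'a list, v :: 'a list). length u + length v = 0} = {([], [])}" by auto
  then show ?case by simp
next
  case (Suc n)
  let ?P = "\<lambda>n. {(u :: 'a list, v :: 'a list). length u + length v = n}"
  let ?d = "\<lambda>a. shuffle_pair (\<lambda>w. f (a # w))"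
  have fin: "finite (?P m)" for m
    by (rule finite_subset[of _ "{u. length u \<le> m} \<times> {v. length v \<le> m}"])
      (use finite_lists_length_le[OF assms] in auto)
  \<comment> \<open>Splitting off the first letter of \<open>w\<close> exposes its two possible
    destinations.\<close>
  have "(\<Sum>w | length w = Suc n. ncscale (f w) (\<Sum>p\<leftarrow>deshuffles w. G p)) =
      (\<Sum>(a, w)\<in>UNIV \<times> {w. length w = n}.
        ncscale (f (a # w)) (\<Sum>p\<leftarrow>deshuffles (a # w). G p))"
    by (rule sum.reindex_bij_witness[of _ "\<lambda>(a, w). a # w" "\<lambda>w. (hd w, tl w)"])
      (auto simp: length_Suc_conv)
  also have "\<dots> = (\<Sum>a\<in>UNIV. \<Sum>w | length w = n. ncscale (f (a # w))
      (\<Sum>p\<leftarrow>deshuffles w. G (a # fst p, snd p) + G (fst p, a # snd p)))"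
    by (simp add: sum.cartesian_product o_def case_prod_unfold sum_list_addf)
  also have "\<dots> = (\<Sum>a\<in>UNIV. \<Sum>(u, v)\<in>?P n. ncscale (?d a u v) (G (a # u, v) + G (u, a # v)))"
    by (simp add: Suc.IH)
  also have "\<dots> = (\<Sum>(a, u, v)\<in>UNIV \<times> ?P n. ncscale (?d a u v) (G (a # u, v))) +
      (\<Sum>(a, u, v)\<in>UNIV \<times> ?P n. ncscale (?d a u v) (G (u, a # v)))"
    by (simp add: sum.cartesian_product case_prod_unfold ncseries.scale_right_distrib sum.distrib)
  also have "(\<Sum>(a, u, v)\<in>UNIV \<times> ?P n. ncscale (?d a u v) (G (a # u, v))) =
      (\<Sum>(u, v)\<in>{p \<in> ?P (Suc n). fst p \<noteq> []}. ncscale (?d (hd u) (tl u) v) (G (u, v)))"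
    by (rule sum.reindex_bij_witness[of _ "\<lambda>(u, v). (hd u, tl u, v)" "\<lambda>(a, u, v). (a # u, v)"])
      (auto simp: neq_Nil_conv)
  \<comment> \<open>Extension by zero covers the clauses of \<open>shuffle_pair\<close> with an
    empty argument, where only one recursive term is present.\<close>
  also have "\<dots> = (\<Sum>(u, v)\<in>?P (Suc n). ncscale (if u = [] then 0 else ?d (hd u) (tl u) v) (G (u, v)))"
    by (rule sum.mono_neutral_cong_left[OF fin]) auto
  also have "(\<Sum>(a, u, v)\<in>UNIV \<times> ?P n. ncscale (?d a u v) (G (u, a # v))) =
      (\<Sum>(u, v)\<in>{p \<in> ?P (Suc n). snd p \<noteq> []}. ncscale (?d (hd v) u (tl v)) (G (u, v)))"
    by (rule sum.reindex_bij_witness[of _ "\<lambda>(u, v). (hd v, u, tl v)" "\<lambda>(a, u, v). (u, a # v)"])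
      (auto simp: neq_Nil_conv)
  also have "\<dots> = (\<Sum>(u, v)\<in>?P (Suc n). ncscale (if v = [] then 0 else ?d (hd v) u (tl v)) (G (u, v)))"
    by (rule sum.mono_neutral_cong_left[OF fin]) auto
  also have "(\<Sum>(u, v)\<in>?P (Suc n). ncscale (if u = [] then 0 else ?d (hd u) (tl u) v) (G (u, v))) +
      (\<Sum>(u, v)\<in>?P (Suc n). ncscale (if v = [] then 0 else ?d (hd v) u (tl v)) (G (u, v))) =
      (\<Sum>(u, v)\<in>?P (Suc n). ncscale (shuffle_pair f u v) (G (u, v)))"
    unfolding sum.distrib[symmetric]
    by (intro sum.cong refl)
      (auto simp: neq_Nil_conv ncseries.scale_left_distrib split: list.splits if_splits)
  finally show ?case .
qed

lemma of_nat_mult_ncscale: "of_nat n * X = ncscale (of_nat n) (X :: 'a ncseries)"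
  by (induction n) (auto simp: algebra_simps)

text \<open>
  The Dynkin--Specht--Wever theorem: for primitive \<open>f\<close> only the terms \<open>u \<otimes> 1\<close> and \<open>1 \<otimes> v\<close> of the
  coproduct survive, and the Dynkin operator kills \<open>1\<close>.
\<close>

lemma sum_dynkin_primitive:
  fixes f :: "'a list \<Rightarrow> complex"
  assumes fin: "finite (UNIV :: 'a set)" and f: "primitive f"
  shows "(\<Sum>w | length w = n. ncscale (f w) (dynkin w)) =
    ncscale (of_nat n) (\<Sum>w | length w = n. ncscale (f w) (word w))"
proof -
  let ?P = "{(u :: 'a list, v :: 'a list). length u + length v = n}"
  let ?g = "\<lambda>(u, v). ncscale (shuffle_pair f u v) (dynkin u * word v)"
  have finP: "finite ?P"
    by (rule finite_subset[of _ "{u. length u \<le> n} \<times> {v. length v \<le> n}"])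
      (use finite_lists_length_le[OF fin] in auto)
  have "(\<Sum>w | length w = n. ncscale (f w) (dynkin w)) = sum ?g {p \<in> ?P. snd p = []}"
    by (rule sum.reindex_bij_witness[of _ fst "\<lambda>w. (w, [])"]) auto
  also have "\<dots> = sum ?g ?P"
  proof (rule sum.mono_neutral_left[OF finP])
    show "\<forall>p\<in>?P - {p \<in> ?P. snd p = []}. ?g p = 0"
    proof
      fix p assume "p \<in> ?P - {p \<in> ?P. snd p = []}"
      then obtain u v where "p = (u, v)" "v \<noteq> []" by (cases p) auto
      then show "?g p = 0" using f by (cases "u = []") (auto simp: primitive_def)
    qed
  qed auto
  also have "\<dots> = (\<Sum>w | length w = n. ncscale (f w) (\<Sum>(u, v)\<leftarrow>deshuffles w. dynkin u * word v))"
    using sum_deshuffles[OF fin, of f "\<lambda>(u, v). dynkin u * word v" n] by (simp add: case_prod_unfold)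
  also have "\<dots> = ncscale (of_nat n) (\<Sum>w | length w = n. ncscale (f w) (word w))"
    unfolding dynkin_convolution_id
    by (simp add: of_nat_mult_ncscale ncseries.scale_sum_right mult.commute)
  finally show ?thesis .
qed

section \<open>From homogeneous primitive series to graded Lie elements\<close>

lemma coeff_sum: "coeff (sum f I) w = (\<Sum>i\<in>I. coeff (f i) w)"
  by (induction I rule: infinite_finite_induct) auto

lemma length_le_word_grade:
  assumes "\<And>a. grade a \<ge> 1"
  shows "length w \<le> word_grade grade w"
  unfolding word_grade_def
proof (induction w)
  case (Cons a w)
  then show ?case using assms[of a] by simp
qed simp

text \<open>The Dynkin argument works by word length rather than grade, so \<open>X\<close> is first
  cut into its length components.\<close>

lemma primitive_homogeneous_free_lie_grade:
  fixes X :: "'a ncseries"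
  assumes fin: "finite (UNIV :: 'a set)" and grade: "\<And>a. grade a \<ge> 1"
    and X: "primitive (coeff X)"
    and hom: "\<And>w. coeff X w \<noteq> 0 \<Longrightarrow> word_grade grade w = q"
  shows "X \<in> free_lie_grade grade q"
proof -
  let ?h = "\<lambda>n. \<Sum>w | length w = n. ncscale (coeff X w) (word w)"
  have finw: "finite {w :: 'a list. length w = n}" for n
    using finite_lists_length_eq[OF fin, of n] by simp
  have h: "coeff (?h n) w = (if length w = n then coeff X w else 0)" for n w
    using finw by (simp add: coeff_sum ncscale.rep_eq coeff_word if_distrib sum.delta cong: if_cong)
  \<comment> \<open>Letters have grade at least 1, so a word of grade \<open>q\<close> has length at
    most \<open>q\<close>; length 0 drops out because the constant term is 0.\<close>
  have "X = (\<Sum>n\<in>{1..q}. ?h n)"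
  proof (rule ncseries_eqI)
    fix w
    have "coeff X w = 0" if "length w \<notin> {1..q}"
      using that X hom[of w] length_le_word_grade[of grade w, OF grade]
      by (cases w) (auto simp: primitive_def)
    then show "coeff X w = coeff (\<Sum>n\<in>{1..q}. ?h n) w"
      unfolding coeff_sum[of ?h "{1..q}"] h by auto
  qed
  also have "\<dots> \<in> free_lie_grade grade q"
    unfolding free_lie_grade_def
  proof (rule ncseries.span_sum)
    fix n assume n: "n \<in> {1..q}"
    \<comment> \<open>Since \<open>n\<close> is at least 1, the factor \<open>n\<close> can be
      divided out.\<close>
    have "?h n = ncscale (1 / of_nat n) (\<Sum>w | length w = n. ncscale (coeff X w) (dynkin w))"
      using n by (simp add: sum_dynkin_primitive[OF fin X])
    also have "\<dots> \<in> ncseries.span {X. pure_element grade q X}"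
    proof (rule ncseries.span_scale, rule ncseries.span_sum)
      fix w :: "'a list" assume "w \<in> {w. length w = n}"
      then have "w \<noteq> []" using n by auto
      then show "ncscale (coeff X w) (dynkin w) \<in> ncseries.span {X. pure_element grade q X}"
        using pure_element_dynkin[of w grade] hom[of w]
        by (cases "coeff X w = 0") (auto intro: ncseries.span_scale ncseries.span_base ncseries.span_zero)
    qed
    finally show "?h n \<in> ncseries.span {X. pure_element grade q X}" .
  qed
  finally show ?thesis .
qed

section \<open>The lowest grade of disagreement\<close>

lemma admissible_grading_finite:
  fixes grade :: "'a \<Rightarrow> nat"
  assumes "admissible_grading grade"
  shows "finite (UNIV :: 'a set)" "grade a \<ge> 1"
proof -
  have "finite (UNIV :: 'a set) \<and> grade a \<ge> 1"
    using assms unfolding admissible_grading_def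
  proof (elim disjE exE conjE)
    fix A B :: 'a
    assume U: "UNIV = {A, B}" and AB: "grade A = 1" "grade B = 1"
    have "a \<in> {A, B}" unfolding U[symmetric] by simp
    moreover have "finite (UNIV :: 'a set)" unfolding U by simp
    ultimately show ?thesis using AB by auto
  next
    fix K and A :: "nat \<Rightarrow> 'a"
    assume bij: "bij_betw A {1..K} UNIV" and A: "\<forall>k\<in>{1..K}. grade (A k) = k"
    obtain k where "k \<in> {1..K}" "a = A k"
      using bij_betw_imp_surj_on[OF bij] by blast
    then show ?thesis using A bij_betw_finite[OF bij] by auto
  qed
  then show "finite (UNIV :: 'a set)" "grade a \<ge> 1" by auto
qed

lemma word_grade_mset:
  assumes "mset w = mset u + mset v"
  shows "word_grade grade w = word_grade grade u + word_grade grade v"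
proof -
  have "image_mset grade (mset w) = image_mset grade (mset u) + image_mset grade (mset v)"
    using assms by simp
  then show ?thesis
    unfolding word_grade_def by (metis mset_map sum_mset.union sum_mset_sum_list)
qed

theorem theorem2p1:
  fixes grade :: "'a \<Rightarrow> nat" and J :: nat
    and \<Phi> :: "nat \<Rightarrow> 'a ncseries" and \<Omega> :: "'a ncseries"
  assumes "admissible_grading grade"
    and "\<And>j. j \<in> {1..J} \<Longrightarrow> \<Phi> j \<in> free_lie"
    and "\<Omega> \<in> free_lie"
    and "prod_list (map (\<lambda>j. ncexp (\<Phi> j)) (rev [1..<Suc J])) \<noteq> ncexp \<Omega>"
  shows "\<exists>q\<ge>1. \<exists>\<Theta>\<in>free_lie_grade grade q. \<exists>R\<in>remainder grade (q + 1).
    \<Theta> \<noteq> 0 \<and>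
    prod_list (map (\<lambda>j. ncexp (\<Phi> j)) (rev [1..<Suc J])) = ncexp \<Omega> + \<Theta> + R"
proof -
  define P where "P = prod_list (map (\<lambda>j. ncexp (\<Phi> j)) (rev [1..<Suc J]))"
  define E where "E = ncexp \<Omega>"
  have P: "grouplike (coeff P)"
    unfolding P_def by (rule grouplike_prod_list) (auto intro!: grouplike_ncexp primitive_free_lie assms(2))
  have E: "grouplike (coeff E)"
    unfolding E_def by (intro grouplike_ncexp primitive_free_lie assms(3))
  have grade: "grade a \<ge> 1" for a using admissible_grading_finite[OF assms(1)] by simp
  define differ where "differ k \<longleftrightarrow> (\<exists>w. word_grade grade w = k \<and> coeff P w \<noteq> coeff E w)" for k
  define q where "q = (LEAST k. differ k)"
  \<comment> \<open>Here the assumed inequality enters. If \<open>P\<close> and \<open>E\<close>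
    were equal, then \<Theta> = -R would be homogeneous of grade \<open>q\<close> and supported in
    higher grades, hence 0.\<close>
  have "\<exists>w. coeff P w \<noteq> coeff E w"
    using assms(4) ncseries_eqI[of P E] unfolding P_def E_def by blast
  then have "\<exists>k. differ k" by (auto simp: differ_def)
  then have "differ q" unfolding q_def by (rule LeastI_ex)
  then obtain w0 where w0: "word_grade grade w0 = q" "coeff P w0 \<noteq> coeff E w0"
    by (auto simp: differ_def)
  have below: "coeff P w = coeff E w" if "word_grade grade w < q" for w
    using that not_less_Least[of "word_grade grade w" differ] by (auto simp: q_def differ_def)
  have pos: "word_grade grade w \<ge> 1" if "w \<noteq> []" for w
    using length_le_word_grade[of grade w, OF grade] that by (cases w) auto
  \<comment> \<open>Both constant terms equal 1.\<close>
  have "w0 \<noteq> []" using w0(2) P E by (auto simp: grouplike_def)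
  then have q1: "q \<ge> 1" using pos w0(1) by blast
  define \<Theta> :: "'a ncseries" where
    "\<Theta> = Abs_ncseries (\<lambda>w. if word_grade grade w = q then coeff P w - coeff E w else 0)"
  have coeff_\<Theta>: "coeff \<Theta> w = (if word_grade grade w = q then coeff P w - coeff E w else 0)" for w
    unfolding \<Theta>_def by (simp add: Abs_ncseries_inverse)
  have "shuffle_pair (coeff \<Theta>) u v = 0" if uv: "u \<noteq> []" "v \<noteq> []" for u v
  proof (cases "word_grade grade u + word_grade grade v = q")
    case True
    then have "shuffle_pair (coeff \<Theta>) u v = shuffle_pair (\<lambda>w. coeff P w - coeff E w) u v"
      by (intro shuffle_pair_cong) (simp add: coeff_\<Theta> word_grade_mset)
    also have "\<dots> = coeff P u * coeff P v - coeff E u * coeff E v"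
      using P E by (simp add: shuffle_pair_diff grouplike_def)
    \<comment> \<open>Both words have positive grade and their grades sum to \<open>q\<close>, so
      each lies below \<open>q\<close>, where \<open>P\<close> and \<open>E\<close> agree.\<close>
    also have "\<dots> = 0"
      using True pos[OF uv(1)] pos[OF uv(2)] by (simp add: below)
    finally show ?thesis .
  next
    case False
    then have "shuffle_pair (coeff \<Theta>) u v = shuffle_pair (\<lambda>w. 0) u v"
      by (intro shuffle_pair_cong) (simp add: coeff_\<Theta> word_grade_mset)
    then show ?thesis by simp
  qed
  moreover have "coeff \<Theta> [] = 0" using P E by (simp add: coeff_\<Theta> grouplike_def)
  ultimately have "primitive (coeff \<Theta>)" by (simp add: primitive_def)
  then have "\<Theta> \<in> free_lie_grade grade q"
    by (rule primitive_homogeneous_free_lie_grade[OF admissible_grading_finite(1)[OF assms(1)] grade])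
      (auto simp: coeff_\<Theta> split: if_splits)
  \<comment> \<open>Below \<open>q\<close> the difference vanishes by minimality; in grade
    \<open>q\<close>, \<Theta> removes it.\<close>
  moreover have "P - E - \<Theta> \<in> remainder grade (q + 1)"
    using below by (force simp: remainder_def coeff_\<Theta> not_less_eq_eq[symmetric] split: if_splits)
  moreover have "\<Theta> \<noteq> 0"
    using w0 coeff_\<Theta>[of w0] by auto
  moreover have "P = E + \<Theta> + (P - E - \<Theta>)" by simp
  ultimately show ?thesis
    using q1 unfolding P_def E_def by blast
qed

end
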